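(* Let $G=(N,E)$ be a finite directed graph. For $k\in\{1,2\}$ let $m_k\in\mathbb N$, $A_k:\mathbb R^N\to\mathbb R^{m_k}$ linear, $b_k\in\mathbb R^{m_k}$, and let $$\mathcal M=\{f\in\mathbb R^N: A_1[f]=b_1,\ A_2[f]\ge b_2\}.$$ Let $H\in C^1(\mathbb R^E_{\ge0})$. For every $i^*\in\operatorname{BP}(G,\mathcal M,H)$ there exist $u_1^*\in\mathbb R^{m_1}$ and $u_2^*\in\mathbb R^{m_2}$ such that, for $u^*=A_1^T[u_1^*]-A_2^T[u_2^*]\in\mathbb R^N$, $$\begin{cases}\min\{i^*,\nabla H(i^* )-Du^*\}=0\ \text{ in }E,\\ \min\{A_2[\operatorname{div}i^*]-b_2,\ u_2^*\}=0,\\ A_1[\operatorname{div}i^*]=b_1.\end{cases}$$ Moreover, if $H$ is convex, then for any $(i,u_1,u_2)\in\mathbb R^E\times\mathbb R^{m_1}\times\mathbb R^{m_2}$ which, with $u=A_1^T[u_1]-A_2^T[u_2]$, satisfies the previous equations (with $i,u,u_2$ in place of $i^*,u^*,u_2^*$), it holds that $i\in\operatorname{BP}(G,\mathcal M,H)$.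
   Context: A directed graph is $G=(N,E)$ with $N$ finite and $E\subseteq N\times N$; for $e=(x,y)$ write $e^-=x$, $e^+=y$. $\operatorname{div}i(x)=\sum_{e^-=x}i(e)-\sum_{e^+=x}i(e)$ and $Du(e)=u(e^+)-u(e^-)$. Vector inequalities and minima are coordinatewise; $A^T$ is the transpose. $C^1(\mathbb R^E_{\ge0})$ means continuously differentiable up to the boundary of the closed nonnegative orthant. The solution set of the Beckmann problem is $\operatorname{BP}(G,\mathcal M,H)=\operatorname{argmin}\{H(i):i\in\mathbb R^E_{\ge0},\ \operatorname{div}i\in\mathcal M\}$. *)

theory Defs
  imports "HOL-Analysis.Analysis" "HOL-Library.Function_Algebras" "Graph_Theory.Pair_Digraph"
begin

text \<open>
  For a finite set \<open>S\<close> (of vertices, of arcs, or \<open>{..<m}\<close>; possibly empty), \<open>\<real>\<^sup>S\<close> is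
  represented by the real functions on the ambient type that vanish outside \<open>S\<close>.
  The pointwise real vector space structure makes the library notions \<^const>\<open>linear\<close> and
  \<^const>\<open>convex_on\<close> available; the order on functions is the coordinatewise one, and the
  topology on functions (the product topology) induces the Euclidean one on \<open>\<real>\<^sup>S\<close>.
\<close>

instantiation "fun" :: (type, scaleR) scaleR
begin
definition "c *\<^sub>R f = (\<lambda>x. c *\<^sub>R f x)"
instance ..
end

lemma scaleR_fun_apply [simp]: "(c *\<^sub>R f) x = c *\<^sub>R f x"
  by (simp add: scaleR_fun_def)

instance "fun" :: (type, real_vector) real_vector
  by standard (simp_all add: fun_eq_iff scaleR_add_right scaleR_add_left)

definition coord_space :: "'a set \<Rightarrow> ('a \<Rightarrow> real) set" where
  "coord_space S = {f. \<forall>x. x \<notin> S \<longrightarrow> f x = 0}"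

definition orthant :: "'a set \<Rightarrow> ('a \<Rightarrow> real) set" where
  "orthant S = {f \<in> coord_space S. 0 \<le> f}"

text \<open>
  A linear map \<open>\<real>\<^sup>S \<rightarrow> \<real>\<^sup>T\<close>. Linearity is demanded on the ambient function space, which is no
  restriction: every linear map on the subspace \<open>\<real>\<^sup>S\<close> has a linear extension, and only the
  values on \<open>\<real>\<^sup>S\<close> are ever used.
\<close>

definition linear_map :: "'a set \<Rightarrow> 'b set \<Rightarrow> (('a \<Rightarrow> real) \<Rightarrow> ('b \<Rightarrow> real)) \<Rightarrow> bool" where
  "linear_map S T A \<longleftrightarrow> linear A \<and> A ` coord_space S \<subseteq> coord_space T"

text \<open>
  The transpose of \<open>A : \<real>\<^sup>S \<rightarrow> \<real>\<^sup>T\<close>; \<open>A (indicator {x}) y\<close> is the matrix entry of \<open>A\<close> in row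
  \<open>y\<close> and column \<open>x\<close>.
\<close>

definition transpose_map ::
  "'a set \<Rightarrow> 'b set \<Rightarrow> (('a \<Rightarrow> real) \<Rightarrow> ('b \<Rightarrow> real)) \<Rightarrow> ('b \<Rightarrow> real) \<Rightarrow> ('a \<Rightarrow> real)" where
  "transpose_map S T A v =
     (\<lambda>x. if x \<in> S then \<Sum>y\<in>T. A (indicator {x}) y * v y else 0)"

text \<open>
  \<open>g\<close> is the gradient at \<open>i\<close> of \<open>H : \<real>\<^sup>E\<^sub>\<ge>\<^sub>0 \<rightarrow> \<real>\<close>, in the sense of Frechet differentiability
  relative to the closed orthant (so one-sided at its boundary). Neither this notion nor those
  below look at values of \<open>H\<close> outside the orthant.
\<close>

definition has_gradient :: "'e set \<Rightarrow> (('e \<Rightarrow> real) \<Rightarrow> real) \<Rightarrow> ('e \<Rightarrow> real) \<Rightarrow> ('e \<Rightarrow> real) \<Rightarrow> bool" where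
  "has_gradient E H i g \<longleftrightarrow> g \<in> coord_space E \<and>
     ((\<lambda>j. (H j - H i - (\<Sum>e\<in>E. g e * (j e - i e))) / L2_set (j - i) E) \<longlongrightarrow> 0)
       (at i within orthant E)"

definition gradient :: "'e set \<Rightarrow> (('e \<Rightarrow> real) \<Rightarrow> real) \<Rightarrow> ('e \<Rightarrow> real) \<Rightarrow> ('e \<Rightarrow> real)" where
  "gradient E H i = (THE g. has_gradient E H i g)"

definition C1_on_orthant :: "'e set \<Rightarrow> (('e \<Rightarrow> real) \<Rightarrow> real) \<Rightarrow> bool" where
  "C1_on_orthant E H \<longleftrightarrow>
     (\<forall>i\<in>orthant E. \<exists>g. has_gradient E H i g) \<and>
     continuous_on (orthant E) (gradient E H)"

definition divergence :: "'v pair_pre_digraph \<Rightarrow> ('v \<times> 'v \<Rightarrow> real) \<Rightarrow> ('v \<Rightarrow> real)" where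
  "divergence G i =
     (\<lambda>x. (\<Sum>e\<in>out_arcs (with_proj G) x. i e) - (\<Sum>e\<in>in_arcs (with_proj G) x. i e))"

definition difference :: "'v pair_pre_digraph \<Rightarrow> ('v \<Rightarrow> real) \<Rightarrow> ('v \<times> 'v \<Rightarrow> real)" where
  "difference G u = (\<lambda>e. if e \<in> parcs G then u (snd e) - u (fst e) else 0)"

definition BP ::
  "'v pair_pre_digraph \<Rightarrow> ('v \<Rightarrow> real) set \<Rightarrow> (('v \<times> 'v \<Rightarrow> real) \<Rightarrow> real) \<Rightarrow> ('v \<times> 'v \<Rightarrow> real) set"
  where
  "BP G M H = {i. is_arg_min H (\<lambda>i. i \<in> orthant (parcs G) \<and> divergence G i \<in> M) i}"

lemma sum_fun_apply:
  fixes F :: "'a \<Rightarrow> 'c \<Rightarrow> real"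
  assumes "finite S"
  shows "(\<Sum>x\<in>S. F x) y = (\<Sum>x\<in>S. F x y)"
  using assms by (induction S rule: finite_induct) auto

lemma transpose_map_adjoint:
  assumes "finite S" "linear_map S T A" "f \<in> coord_space S"
  shows "(\<Sum>y\<in>T. A f y * v y) = (\<Sum>x\<in>S. f x * transpose_map S T A v x)"
proof -
  have lin: "linear A" using assms(2) by (simp add: linear_map_def)
  have f: "f = (\<Sum>x\<in>S. f x *\<^sub>R indicator {x})"
  proof
    fix z
    show "f z = (\<Sum>x\<in>S. f x *\<^sub>R indicator {x}) z"
      using assms(1,3)
      by (cases "z \<in> S") (auto simp: sum_fun_apply[OF \<open>finite S\<close>] indicator_def coord_space_def if_distrib sum.delta
          cong: if_cong)
  qed
  have "A f = (\<Sum>x\<in>S. f x *\<^sub>R A (indicator {x}))"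
    by (subst f) (simp add: linear_sum[OF lin] linear_scale[OF lin])
  then have "A f y = (\<Sum>x\<in>S. f x * A (indicator {x}) y)" for y
    using \<open>finite S\<close> by (simp add: sum_fun_apply[OF \<open>finite S\<close>])
  then have "(\<Sum>y\<in>T. A f y * v y) = (\<Sum>y\<in>T. \<Sum>x\<in>S. f x * A (indicator {x}) y * v y)"
    by (simp add: sum_distrib_right)
  also have "\<dots> = (\<Sum>x\<in>S. \<Sum>y\<in>T. f x * A (indicator {x}) y * v y)"
    by (rule sum.swap)
  finally show ?thesis
    by (simp add: transpose_map_def sum_distrib_left mult.assoc)
qed

lemma has_gradient_unique:
  assumes "finite E" "i \<in> orthant E" "has_gradient E H i g" "has_gradient E H i h"
  shows "g = h"
proof
  fix e
  show "g e = h e"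
  proof (cases "e \<in> E")
    case False
    then show ?thesis using assms by (auto simp: has_gradient_def coord_space_def)
  next
    case True
    define p where "p t = i(e := i e + t)" for t :: real
    have p: "filterlim p (at i within orthant E) (at_right 0)"
      unfolding filterlim_at
    proof
      show "\<forall>\<^sub>F t in at_right 0. p t \<in> orthant E \<and> p t \<noteq> i"
        unfolding eventually_at_right_field using assms(2) True
        by (intro exI[of _ 1]) (auto simp: p_def orthant_def coord_space_def le_fun_def fun_eq_iff)
      have "continuous_on UNIV p"
      proof (rule continuous_on_coordinatewise_then_product)
        show "continuous_on UNIV (\<lambda>t. p t k)" for k
          by (cases "k = e") (auto simp: p_def intro!: continuous_intros)
      qed
      then have "(p \<longlongrightarrow> p 0) (at_right 0)"
        by (auto simp: continuous_on_def intro: tendsto_within_subset)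
      then show "(p \<longlongrightarrow> i) (at_right 0)" by (simp add: p_def)
    qed
    have lim: "((\<lambda>t. (H (p t) - H i - k e * t) / t) \<longlongrightarrow> 0) (at_right 0)"
      if "has_gradient E H i k" for k
    proof -
      have "((\<lambda>j. (H j - H i - (\<Sum>e\<in>E. k e * (j e - i e))) / L2_set (j - i) E) \<longlongrightarrow> 0)
        (at i within orthant E)" using that by (simp add: has_gradient_def)
      note * = filterlim_compose[OF this p]
      have s: "(\<Sum>x\<in>E. k x * (p t x - i x)) = k e * t" for t
      proof -
        have "(\<Sum>x\<in>E. k x * (p t x - i x)) = (\<Sum>x\<in>E. if x = e then k e * t else 0)"
          by (rule sum.cong) (auto simp: p_def)
        then show ?thesis using \<open>finite E\<close> True by simp
      qed
      have n: "L2_set (p t - i) E = \<bar>t\<bar>" for t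
      proof -
        have "(\<Sum>x\<in>E. ((p t - i) x)\<^sup>2) = (\<Sum>x\<in>E. if x = e then t\<^sup>2 else 0)"
          by (rule sum.cong) (auto simp: p_def)
        then show ?thesis using \<open>finite E\<close> True by (simp add: L2_set_def)
      qed
      show ?thesis
        by (rule Lim_transform_eventually[OF *])
          (auto simp: s n eventually_at_right_field intro!: exI[of _ 1])
    qed
    have "((\<lambda>t. (H (p t) - H i - g e * t) / t - (H (p t) - H i - h e * t) / t) \<longlongrightarrow> 0 - 0)
      (at_right 0)"
      by (intro tendsto_diff lim assms)
    moreover have "\<forall>\<^sub>F t in at_right 0.
        (H (p t) - H i - g e * t) / t - (H (p t) - H i - h e * t) / t = h e - g e"
      by (auto simp: eventually_at_right_field field_simps intro!: exI[of _ 1])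
    ultimately have "((\<lambda>t::real. h e - g e) \<longlongrightarrow> 0 - 0) (at_right 0)"
      by (rule Lim_transform_eventually)
    then show ?thesis by (simp add: tendsto_const_iff)
  qed
qed

end

theory Submission
  imports Defs
begin

text \<open>
  At a minimiser \<open>i\<close>, every direction \<open>d\<close> satisfying the linearised active constraints stays
  feasible for a short time, because all constraints are affine; hence \<open>\<nabla>H(i) \<cdot> d \<ge> 0\<close>. Farkas'
  lemma turns this into multipliers, and since divergence and \<open>-D\<close> are adjoint, testing with
  unit vectors gives the system. Conversely, if \<open>H\<close> is convex, then
  \<open>H j - H i \<ge> \<nabla>H(i) \<cdot> (j - i) \<ge> Du \<cdot> (j - i) = u\<^sub>2 \<cdot> (A\<^sub>2[div j] - b\<^sub>2) \<ge> 0\<close>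
  for every feasible \<open>j\<close>.
\<close>

section \<open>Farkas' lemma\<close>

text \<open>
  Bartl's algebraic proof, which works in any real vector space: in the induction step, \<open>f\<close> and the
  remaining functionals are precomposed with a projection onto the kernel of the new one.
\<close>

lemma farkas:
  fixes f :: "'a::real_vector \<Rightarrow> real" and g :: "'i \<Rightarrow> 'a \<Rightarrow> real"
  assumes "finite I" "linear f" "\<And>k. k \<in> I \<Longrightarrow> linear (g k)"
    and "\<And>x. (\<And>k. k \<in> I \<Longrightarrow> 0 \<le> g k x) \<Longrightarrow> 0 \<le> f x"
  shows "\<exists>c. (\<forall>k\<in>I. 0 \<le> c k) \<and> (\<forall>x. f x = (\<Sum>k\<in>I. c k * g k x))"
  using assms
proof (induction I arbitrary: f g rule: finite_induct)
  case empty
  have "f x = 0" for x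
    using empty(3)[of x] empty(3)[of "- x"] linear_neg[OF empty(1), of x] by simp
  then show ?case by auto
next
  case (insert n I)
  show ?case
  proof (cases "\<forall>x. (\<forall>k\<in>I. 0 \<le> g k x) \<longrightarrow> 0 \<le> f x")
    case True
    then obtain c where c: "\<forall>k\<in>I. 0 \<le> c k" "\<forall>x. f x = (\<Sum>k\<in>I. c k * g k x)"
      using insert.IH[of f g] insert.prems by blast
    \<comment> \<open>The constraints in \<open>I\<close> already force \<open>0 \<le> f x\<close>,
      so the new functional receives multiplier 0.\<close>
    have "(\<Sum>k\<in>I. (c(n := 0)) k * g k x) = (\<Sum>k\<in>I. c k * g k x)" for x
      using insert.hyps by (intro sum.cong) auto
    then show ?thesis using c insert.hyps by (intro exI[of _ "c(n := 0)"]) auto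
  next
    case False
    then obtain z where z: "\<forall>k\<in>I. 0 \<le> g k z" "f z < 0" by (auto simp: not_le)
    have lf: "linear f" and lg: "\<And>k. k \<in> insert n I \<Longrightarrow> linear (g k)"
      using insert.prems by auto
    \<comment> \<open>If \<open>0 \<le> g n z\<close>, then \<open>z\<close> would satisfy every
      constraint in \<open>insert n I\<close> although \<open>f z < 0\<close>. The strict sign
      allows rescaling \<open>z\<close> by a positive factor to a \<open>y\<close> with
      \<open>g n y = - 1\<close>.\<close>
    have neg: "g n z < 0"
      using insert.prems(3)[of z] z by force
    define y where "y = inverse (- g n z) *\<^sub>R z"
    have sc: "h y = inverse (- g n z) * h z" if "linear h" for h :: "'a \<Rightarrow> real"
      unfolding y_def linear_scale[OF that] by simp
    have y: "\<forall>k\<in>I. 0 \<le> g k y" "f y < 0" "g n y = - 1"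
      using z neg by (auto simp: sc lf lg mult_nonpos_nonneg mult_neg_neg mult_pos_neg
          divide_simps simp del: inverse_minus_eq)
    \<comment> \<open>Because \<open>g n y = - 1\<close>, \<open>P\<close> moves \<open>x\<close>
      along \<open>y\<close> into the kernel of \<open>g n\<close>. Constraint \<open>n\<close>
      therefore holds at every \<open>P x\<close>, and the constraints in \<open>I\<close> suffice
      for the composed functionals.\<close>
    define P where "P x = x + g n x *\<^sub>R y" for x
    have lP: "linear P"
      using lg[of n] unfolding P_def
      by (intro linearI) (auto simp: linear_add linear_scale algebra_simps)
    have P: "h (P x) = h x + g n x * h y" if "linear h" for h :: "'a \<Rightarrow> real" and x
      using that by (simp add: P_def linear_add linear_scale)
    have "\<exists>c. (\<forall>k\<in>I. 0 \<le> c k) \<and> (\<forall>x. (f \<circ> P) x = (\<Sum>k\<in>I. c k * (g k \<circ> P) x))"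
    proof (rule insert.IH)
      show "linear (f \<circ> P)" by (rule linear_compose[OF lP lf])
      show "linear (g k \<circ> P)" if "k \<in> I" for k
        using that by (intro linear_compose[OF lP lg]) auto
      fix x assume *: "\<And>k. k \<in> I \<Longrightarrow> 0 \<le> (g k \<circ> P) x"
      have "g n (P x) = 0" using y(3) P[OF lg[of n], of x] by simp
      then show "0 \<le> (f \<circ> P) x"
        unfolding comp_def using * by (intro insert.prems(3)) auto
    qed
    then obtain c where c: "\<forall>k\<in>I. 0 \<le> c k" "\<And>x. f (P x) = (\<Sum>k\<in>I. c k * g k (P x))"
      by auto
    \<comment> \<open>Expanding \<open>f (P x) = f x + g n x * f y\<close>, and likewise each
      \<open>g k (P x)\<close>, and solving for \<open>f x\<close> leaves exactly this coefficient
      of \<open>g n x\<close>. It is nonnegative since \<open>f y < 0\<close> and every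
      \<open>g k y\<close> is nonnegative.\<close>
    define c' where "c' = c(n := (\<Sum>k\<in>I. c k * g k y) - f y)"
    have nonneg: "\<forall>k\<in>insert n I. 0 \<le> c' k"
    proof -
      have "0 \<le> (\<Sum>k\<in>I. c k * g k y)" using c(1) y(1) by (intro sum_nonneg) auto
      then show ?thesis using c(1) y(2) by (auto simp: c'_def)
    qed
    have "f x = (\<Sum>k\<in>insert n I. c' k * g k x)" for x
    proof -
      have "f x + g n x * f y = (\<Sum>k\<in>I. c k * (g k x + g n x * g k y))"
        using c(2)[of x] P[OF lf, of x] P[OF lg, of _ x] by simp
      also have "\<dots> = (\<Sum>k\<in>I. c k * g k x) + g n x * (\<Sum>k\<in>I. c k * g k y)"
        by (simp add: sum.distrib sum_distrib_left algebra_simps)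
      moreover have "(\<Sum>k\<in>I. c' k * g k x) = (\<Sum>k\<in>I. c k * g k x)"
        using insert.hyps by (intro sum.cong) (auto simp: c'_def)
      ultimately show ?thesis using insert.hyps by (simp add: c'_def algebra_simps)
    qed
    then show ?thesis using nonneg by blast
  qed
qed

text \<open>Each equation \<open>h k x = 0\<close> is split into the inequalities for
  \<open>h k\<close> and its negative. The difference of their two nonnegative multipliers is a
  multiplier of arbitrary sign.\<close>

lemma farkas_mixed:
  fixes f :: "'a::real_vector \<Rightarrow> real"
    and g :: "'i \<Rightarrow> 'a \<Rightarrow> real" and h :: "'j \<Rightarrow> 'a \<Rightarrow> real"
  assumes fin: "finite I" "finite J" and lf: "linear f"
    and lg: "\<And>k. k \<in> I \<Longrightarrow> linear (g k)" and lh: "\<And>k. k \<in> J \<Longrightarrow> linear (h k)"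
    and pos: "\<And>x. (\<And>k. k \<in> I \<Longrightarrow> 0 \<le> g k x) \<Longrightarrow> (\<And>k. k \<in> J \<Longrightarrow> h k x = 0) \<Longrightarrow> 0 \<le> f x"
  obtains c d where "\<And>k. k \<in> I \<Longrightarrow> 0 \<le> c k"
    "\<And>x. f x = (\<Sum>k\<in>I. c k * g k x) + (\<Sum>k\<in>J. d k * h k x)"
proof -
  define G where "G = case_sum g (case_sum h (\<lambda>k x. - h k x))"
  have "\<exists>c. (\<forall>k\<in>I <+> (J <+> J). 0 \<le> c k) \<and> (\<forall>x. f x = (\<Sum>k\<in>I <+> (J <+> J). c k * G k x))"
  proof (rule farkas)
    show "linear (G k)" if "k \<in> I <+> (J <+> J)" for k
      using that lg lh by (auto simp: G_def linear_iff)
    fix x assume *: "\<And>k. k \<in> I <+> (J <+> J) \<Longrightarrow> 0 \<le> G k x"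
    show "0 \<le> f x"
    proof (rule pos)
      show "0 \<le> g k x" if "k \<in> I" for k using *[of "Inl k"] that by (auto simp: G_def)
      show "h k x = 0" if "k \<in> J" for k
        using *[of "Inr (Inl k)"] *[of "Inr (Inr k)"] that by (force simp: G_def)
    qed
  qed (use fin lf in auto)
  then obtain c where c: "\<forall>k\<in>I <+> (J <+> J). 0 \<le> c k"
    "\<And>x. f x = (\<Sum>k\<in>I <+> (J <+> J). c k * G k x)" by blast
  show thesis
  proof
    show "0 \<le> c (Inl k)" if "k \<in> I" for k using c(1) that by auto
    show "f x = (\<Sum>k\<in>I. c (Inl k) * g k x)
        + (\<Sum>k\<in>J. (c (Inr (Inl k)) - c (Inr (Inr k))) * h k x)" for x
      using fin by (simp add: c(2) sum.Plus G_def algebra_simps sum.distrib sum_subtractf sum_negf)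
  qed
qed

section \<open>Derivatives along feasible directions\<close>

lemma orthantI: "i \<in> coord_space E \<Longrightarrow> (\<And>e. 0 \<le> i e) \<Longrightarrow> i \<in> orthant E"
  by (simp add: orthant_def le_fun_def)

lemma orthantD: "i \<in> orthant E \<Longrightarrow> 0 \<le> i e"
  by (simp add: orthant_def le_fun_def)

lemma gradient_has_gradient:
  assumes "finite E" "C1_on_orthant E H" "i \<in> orthant E"
  shows "has_gradient E H i (gradient E H i)"
proof -
  obtain g where g: "has_gradient E H i g" using assms by (auto simp: C1_on_orthant_def)
  then have "gradient E H i = g"
    unfolding gradient_def by (intro the_equality has_gradient_unique[OF assms(1,3)])
  then show ?thesis using g by simp
qed

text \<open>The Frechet limit is composed with the ray \<open>i + t *\<^sub>R d\<close>, which need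
  only lie in the orthant for small positive \<open>t\<close>. This covers boundary points, where
  derivatives are one-sided.\<close>

lemma has_gradient_directional:
  assumes fin: "finite E" and grad: "has_gradient E H i g" and d: "d \<in> coord_space E"
    and feas: "\<forall>\<^sub>F t in at_right 0. i + t *\<^sub>R d \<in> orthant E"
  shows "((\<lambda>t. (H (i + t *\<^sub>R d) - H i) / t) \<longlongrightarrow> (\<Sum>e\<in>E. g e * d e)) (at_right 0)"
proof (cases "d = 0")
  \<comment> \<open>The punctured filter at \<open>i\<close> excludes the constant ray, so the zero
    direction is treated apart.\<close>
  case True
  then have "i + t *\<^sub>R d = i" for t by (metis add_0_right scaleR_zero_right)
  moreover have "d e = 0" for e using True by simp
  ultimately show ?thesis by (simp only: diff_self div_0 mult_zero_right sum.neutral_const tendsto_const)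
next
  case False
  then obtain e where e: "d e \<noteq> 0" "e \<in> E" using d by (auto simp: coord_space_def fun_eq_iff)
  have n0: "L2_set d E \<noteq> 0" using e fin by (auto simp: L2_set_eq_0_iff)
  define p where "p t = i + t *\<^sub>R d" for t :: real
  have pos: "\<forall>\<^sub>F t in at_right (0::real). 0 < t"
    by (auto simp: eventually_at_right_field intro: exI[of _ 1])
  have "filterlim p (at i within orthant E) (at_right 0)"
    unfolding filterlim_at
  proof
    show "\<forall>\<^sub>F t in at_right 0. p t \<in> orthant E \<and> p t \<noteq> i"
      using feas pos by eventually_elim (use False in \<open>auto simp: p_def\<close>)
    have "continuous_on UNIV p"
      by (rule continuous_on_coordinatewise_then_product)
        (auto simp: p_def intro!: continuous_intros)
    then have "(p \<longlongrightarrow> p 0) (at_right 0)"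
      by (auto simp: continuous_on_def intro: tendsto_within_subset)
    then show "(p \<longlongrightarrow> i) (at_right 0)" by (simp add: p_def)
  qed
  from filterlim_compose[OF _ this] grad
  have "((\<lambda>t. (H (p t) - H i - (\<Sum>e\<in>E. g e * (p t e - i e))) / L2_set (p t - i) E) \<longlongrightarrow> 0)
      (at_right 0)"
    by (auto simp: has_gradient_def)
  \<comment> \<open>The displacement has norm \<open>t * L2_set d E\<close>. Multiplying by
    \<open>L2_set d E\<close> and adding back the linear term turns the Frechet quotient into the
    difference quotient for \<open>t > 0\<close>.\<close>
  then have "((\<lambda>t. (H (p t) - H i - (\<Sum>e\<in>E. g e * (p t e - i e))) / L2_set (p t - i) E * L2_set d E
      + (\<Sum>e\<in>E. g e * d e)) \<longlongrightarrow> 0 * L2_set d E + (\<Sum>e\<in>E. g e * d e)) (at_right 0)"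
    by (intro tendsto_intros)
  then have "((\<lambda>t. (H (i + t *\<^sub>R d) - H i) / t) \<longlongrightarrow> 0 * L2_set d E + (\<Sum>e\<in>E. g e * d e))
      (at_right 0)"
  proof (rule Lim_transform_eventually)
    show "\<forall>\<^sub>F t in at_right 0.
        (H (p t) - H i - (\<Sum>e\<in>E. g e * (p t e - i e))) / L2_set (p t - i) E * L2_set d E
        + (\<Sum>e\<in>E. g e * d e) = (H (i + t *\<^sub>R d) - H i) / t"
      using pos
    proof eventually_elim
      case (elim t)
      have "L2_set (p t - i) E = t * L2_set d E"
        using elim by (simp add: p_def L2_set_right_distrib scaleR_fun_def)
      moreover have "(\<Sum>e\<in>E. g e * (p t e - i e)) = t * (\<Sum>e\<in>E. g e * d e)"
        by (simp add: p_def sum_distrib_left algebra_simps)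
      ultimately show ?case using elim n0 by (simp add: p_def field_simps)
    qed
  qed
  then show ?thesis by simp
qed

text \<open>Convexity bounds every difference quotient along the segment from \<open>i\<close> to
  \<open>j\<close> by \<open>H j - H i\<close>; the bound survives the limit at 0.\<close>

lemma has_gradient_convex_le:
  assumes fin: "finite E" and cv: "convex_on (orthant E) H" and grad: "has_gradient E H i g"
    and i: "i \<in> orthant E" and j: "j \<in> orthant E"
  shows "(\<Sum>e\<in>E. g e * (j e - i e)) \<le> H j - H i"
proof -
  have t: "\<forall>\<^sub>F t in at_right (0::real). 0 < t \<and> t < 1"
    by (auto simp: eventually_at_right_field intro: exI[of _ 1])
  have eq: "i + t *\<^sub>R (j - i) = (1 - t) *\<^sub>R i + t *\<^sub>R j" for t
    by (simp add: algebra_simps)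
  have ev: "\<forall>\<^sub>F t in at_right 0. i + t *\<^sub>R (j - i) \<in> orthant E"
    using t
  proof eventually_elim
    case (elim t)
    then show ?case unfolding eq
      using cv i j by (intro convexD) (auto simp: convex_on_def)
  qed
  have "((\<lambda>t. (H (i + t *\<^sub>R (j - i)) - H i) / t) \<longlongrightarrow> (\<Sum>e\<in>E. g e * (j - i) e)) (at_right 0)"
    using i j by (intro has_gradient_directional fin grad ev) (auto simp: orthant_def coord_space_def)
  then have "(\<Sum>e\<in>E. g e * (j - i) e) \<le> H j - H i"
  proof (rule tendsto_upperbound)
    show "\<forall>\<^sub>F t in at_right 0. (H (i + t *\<^sub>R (j - i)) - H i) / t \<le> H j - H i"
      using t
    proof eventually_elim
      case (elim t)
      have "H (i + t *\<^sub>R (j - i)) \<le> (1 - t) * H i + t * H j"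
        unfolding eq using elim i j by (intro convex_onD[OF cv]) auto
      then show ?case using elim by (simp add: field_simps)
    qed
  qed simp
  then show ?thesis by simp
qed

text \<open>Short-time feasibility of one affine constraint: an inactive one (\<open>a > 0\<close>)
  persists by continuity, and an active one (\<open>a = 0\<close>) needs only a nonnegative
  slope.\<close>

lemma eventually_affine_nonneg:
  fixes a b :: real
  assumes "0 \<le> a" "a = 0 \<Longrightarrow> 0 \<le> b"
  shows "\<forall>\<^sub>F t in at_right 0. 0 \<le> a + t * b"
proof (cases "a = 0")
  case True
  then show ?thesis using assms by (auto simp: eventually_at_right_field intro: exI[of _ 1])
next
  case False
  have "((\<lambda>t. a + t * b) \<longlongrightarrow> a + 0 * b) (at_right 0)" by (intro tendsto_intros)
  then have "\<forall>\<^sub>F t in at_right 0. 0 < a + t * b"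
    using False assms by (intro order_tendstoD) auto
  then show ?thesis by eventually_elim simp
qed

section \<open>The divergence operator\<close>

lemma divergence_eq:
  "divergence G i x = (\<Sum>e | e \<in> parcs G \<and> fst e = x. i e) - (\<Sum>e | e \<in> parcs G \<and> snd e = x. i e)"
  by (simp add: divergence_def out_arcs_def in_arcs_def)

lemma linear_divergence: "linear (divergence G)"
  by (intro linearI ext)
    (simp_all add: divergence_eq sum.distrib sum_distrib_left right_diff_distrib)

lemma divergence_cong:
  assumes "\<And>e. e \<in> parcs G \<Longrightarrow> i e = j e"
  shows "divergence G i = divergence G j"
proof
  have "sum i {e \<in> parcs G. P e} = sum j {e \<in> parcs G. P e}" for P
    using assms by (intro sum.cong) auto
  then show "divergence G i x = divergence G j x" for x by (simp only: divergence_eq)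
qed

lemma divergence_in_coord_space:
  assumes "pair_wf_digraph G"
  shows "divergence G i \<in> coord_space (pverts G)"
proof -
  interpret pair_wf_digraph G by fact
  have "{e \<in> parcs G. fst e = x} = {}" "{e \<in> parcs G. snd e = x} = {}" if "x \<notin> pverts G" for x
    using that in_arcsD1 in_arcsD2 by fastforce+
  then have "divergence G i x = 0" if "x \<notin> pverts G" for x
    unfolding divergence_eq using that by (simp only: sum.empty diff_self not_False_eq_True)
  then show ?thesis unfolding coord_space_def by blast
qed

text \<open>Regrouping the vertex sum by arcs, each arc contributes its flow times \<open>u\<close>
  at the tail minus \<open>u\<close> at the head.\<close>

lemma divergence_adjoint:
  assumes "pair_fin_digraph G"
  shows "(\<Sum>x\<in>pverts G. divergence G i x * u x) = - (\<Sum>e\<in>parcs G. i e * difference G u e)"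
proof -
  interpret pair_fin_digraph G by fact
  \<comment> \<open>Here \<open>q\<close> stands for either endpoint map, \<open>fst\<close> or
    \<open>snd\<close>.\<close>
  have grp: "(\<Sum>x\<in>pverts G. (\<Sum>e | e \<in> parcs G \<and> q e = x. i e) * u x) = (\<Sum>e\<in>parcs G. i e * u (q e))"
    if q: "q ` parcs G \<subseteq> pverts G" for q
  proof -
    have "(\<Sum>x\<in>pverts G. (\<Sum>e | e \<in> parcs G \<and> q e = x. i e) * u x)
        = (\<Sum>x\<in>pverts G. \<Sum>e | e \<in> parcs G \<and> q e = x. i e * u (q e))"
      by (simp add: sum_distrib_right)
    also have "\<dots> = (\<Sum>e\<in>parcs G. i e * u (q e))"
      by (rule sum.group) (use q in auto)
    finally show ?thesis .
  qed
  have "fst ` parcs G \<subseteq> pverts G" "snd ` parcs G \<subseteq> pverts G"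
    using in_arcsD1 in_arcsD2 by fastforce+
  then have "(\<Sum>x\<in>pverts G. divergence G i x * u x)
      = (\<Sum>e\<in>parcs G. i e * u (fst e)) - (\<Sum>e\<in>parcs G. i e * u (snd e))"
    by (simp add: divergence_eq left_diff_distrib sum_subtractf grp)
  also have "\<dots> = - (\<Sum>e\<in>parcs G. i e * difference G u e)"
    by (simp add: difference_def right_diff_distrib sum_subtractf)
  finally show ?thesis .
qed

theorem lemma3p10:
  fixes G :: "'v pair_pre_digraph"
    and m1 m2 :: nat
    and A1 A2 :: "('v \<Rightarrow> real) \<Rightarrow> (nat \<Rightarrow> real)"
    and b1 b2 :: "nat \<Rightarrow> real"
    and M :: "('v \<Rightarrow> real) set"
    and H :: "('v \<times> 'v \<Rightarrow> real) \<Rightarrow> real"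
    and u :: "(nat \<Rightarrow> real) \<Rightarrow> (nat \<Rightarrow> real) \<Rightarrow> ('v \<Rightarrow> real)"
  assumes G: "pair_fin_digraph G"
    and A1: "linear_map (pverts G) {..<m1} A1"
    and A2: "linear_map (pverts G) {..<m2} A2"
    and b1: "b1 \<in> coord_space {..<m1}"
    and b2: "b2 \<in> coord_space {..<m2}"
    and M_def: "M = {f \<in> coord_space (pverts G). A1 f = b1 \<and> A2 f \<ge> b2}"
    and H: "C1_on_orthant (parcs G) H"
    and u_def: "\<And>u1 u2. u u1 u2 =
      transpose_map (pverts G) {..<m1} A1 u1 - transpose_map (pverts G) {..<m2} A2 u2"
  shows
    "(\<forall>i\<in>BP G M H. \<exists>u1\<in>coord_space {..<m1}. \<exists>u2\<in>coord_space {..<m2}.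
        (\<forall>e\<in>parcs G. min (i e) ((gradient (parcs G) H i - difference G (u u1 u2)) e) = 0) \<and>
        (\<forall>k<m2. min ((A2 (divergence G i) - b2) k) (u2 k) = 0) \<and>
        A1 (divergence G i) = b1)
     \<and>
     (convex_on (orthant (parcs G)) H \<longrightarrow>
      (\<forall>i\<in>coord_space (parcs G). \<forall>u1\<in>coord_space {..<m1}. \<forall>u2\<in>coord_space {..<m2}.
        (\<forall>e\<in>parcs G. min (i e) ((gradient (parcs G) H i - difference G (u u1 u2)) e) = 0) \<and>
        (\<forall>k<m2. min ((A2 (divergence G i) - b2) k) (u2 k) = 0) \<and>
        A1 (divergence G i) = b1
        \<longrightarrow> i \<in> BP G M H))"
proof -
  interpret pair_fin_digraph G by (rule G)
  let ?E = "parcs G" and ?V = "pverts G"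
  let ?g = "gradient ?E H" and ?div = "divergence G"
  have finE: "finite ?E" and finV: "finite ?V" by auto

  \<comment> \<open>Constraints as functionals of the flow\<close>
  have div: "?div d \<in> coord_space ?V" for d
    by (rule divergence_in_coord_space) unfold_locales
  have lin: "linear (\<lambda>d. A (?div d) k)" if "linear_map ?V T A" for T A and k :: nat
  proof -
    have "linear (A \<circ> ?div)"
      using that by (intro linear_compose linear_divergence) (simp add: linear_map_def)
    then show ?thesis by (auto simp: linear_iff)
  qed
  \<comment> \<open>The minus sign from \<open>divergence_adjoint\<close> meets the signs in
    \<open>u\<close>, so the \<open>A2\<close> term comes out positive and the \<open>A1\<close>
    term negative.\<close>
  have adj: "(\<Sum>e\<in>?E. difference G (u u1 u2) e * d e)
      = (\<Sum>k<m2. A2 (?div d) k * u2 k) - (\<Sum>k<m1. A1 (?div d) k * u1 k)" for d u1 u2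
  proof -
    have "(\<Sum>e\<in>?E. difference G (u u1 u2) e * d e) = - (\<Sum>x\<in>?V. ?div d x * u u1 u2 x)"
      by (simp add: divergence_adjoint[OF G] mult.commute)
    also have "\<dots> = (\<Sum>k<m2. A2 (?div d) k * u2 k) - (\<Sum>k<m1. A1 (?div d) k * u1 k)"
      by (simp add: u_def right_diff_distrib sum_subtractf
          transpose_map_adjoint[OF finV A1 div] transpose_map_adjoint[OF finV A2 div])
    finally show ?thesis .
  qed
  have feasible: "?div i \<in> M \<longleftrightarrow> A1 (?div i) = b1 \<and> (\<forall>k<m2. b2 k \<le> A2 (?div i) k)" for i
  proof -
    have "A2 (?div i) \<in> coord_space {..<m2}"
      using A2 div by (auto simp: linear_map_def)
    \<comment> \<open>The order compares functions on all of \<open>nat\<close>; beyond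
      \<open>m2\<close> both sides vanish.\<close>
    then have "A2 (?div i) \<ge> b2 \<longleftrightarrow> (\<forall>k<m2. b2 k \<le> A2 (?div i) k)"
      using b2 by (auto simp: le_fun_def coord_space_def) (metis not_less order_refl)
    then show ?thesis using div by (simp add: M_def)
  qed

  \<comment> \<open>Necessity: multipliers at a minimiser\<close>
  have nec: "\<exists>u1\<in>coord_space {..<m1}. \<exists>u2\<in>coord_space {..<m2}.
      (\<forall>e\<in>?E. min (i e) ((?g i - difference G (u u1 u2)) e) = 0) \<and>
      (\<forall>k<m2. min ((A2 (?div i) - b2) k) (u2 k) = 0) \<and> A1 (?div i) = b1"
    if "i \<in> BP G M H" for i
  proof -
    have iO: "i \<in> orthant ?E" and iM: "?div i \<in> M"
      and opt: "\<And>j. j \<in> orthant ?E \<Longrightarrow> ?div j \<in> M \<Longrightarrow> H i \<le> H j"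
      using that by (auto simp: BP_def is_arg_min_def not_less)
    have i0: "0 \<le> i e" for e using iO by (rule orthantD)
    have A1i: "A1 (?div i) = b1" and A2i: "\<And>k. k < m2 \<Longrightarrow> b2 k \<le> A2 (?div i) k"
      using iM by (auto simp: feasible)
    \<comment> \<open>\<open>Z\<close> and \<open>K\<close> collect the active inequalities: arcs
      without flow and tight rows of \<open>A2\<close>. Only these restrict directions to first
      order.\<close>
    define Z where "Z = {e \<in> ?E. i e = 0}"
    define K where "K = {k. k < m2 \<and> A2 (?div i) k = b2 k}"
    have finZ: "finite Z" and finK: "finite K" using finE by (auto simp: Z_def K_def)
    define g where "g = case_sum (\<lambda>e (d :: 'v \<times> 'v \<Rightarrow> real). d e) (\<lambda>k d. A2 (?div d) k)"
    obtain c \<mu> where c: "\<And>k. k \<in> Z <+> K \<Longrightarrow> 0 \<le> c k" and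
      rep: "\<And>d. (\<Sum>e\<in>?E. ?g i e * d e) = (\<Sum>k\<in>Z <+> K. c k * g k d) + (\<Sum>k<m1. \<mu> k * A1 (?div d) k)"
    proof (rule farkas_mixed[where I = "Z <+> K" and J = "{..<m1}" and g = g
          and h = "\<lambda>k d. A1 (?div d) k" and f = "\<lambda>d. \<Sum>e\<in>?E. ?g i e * d e"])
      show "linear (\<lambda>d. \<Sum>e\<in>?E. ?g i e * d e)"
        by (intro linearI) (simp_all add: sum.distrib sum_distrib_left algebra_simps)
      show "linear (g k)" if "k \<in> Z <+> K" for k
        by (cases k) (auto simp: g_def lin[OF A2] intro!: linearI)
      fix d0
      assume g0: "\<And>k. k \<in> Z <+> K \<Longrightarrow> 0 \<le> g k d0"
        and h0: "\<And>k. k \<in> {..<m1} \<Longrightarrow> A1 (?div d0) k = 0"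
      \<comment> \<open>Farkas' lemma ranges over all functions on pairs, whereas a feasible
        direction must vanish off the arcs. Truncation preserves the divergence and the values on
        arcs.\<close>
      define d where "d e = (if e \<in> ?E then d0 e else 0)" for e
      have dE: "d \<in> coord_space ?E" by (simp add: d_def coord_space_def)
      have dd: "?div d = ?div d0" by (rule divergence_cong) (simp add: d_def)
      have "A1 (?div d) \<in> coord_space {..<m1}" using A1 div by (auto simp: linear_map_def)
      with h0 have A1d: "A1 (?div d) k = 0" for k
        by (cases "k < m1") (auto simp: dd coord_space_def)
      have Zd: "0 \<le> d e" if "e \<in> ?E" "i e = 0" for e
        using g0[of "Inl e"] that by (auto simp: g_def d_def Z_def)
      have Kd: "0 \<le> A2 (?div d) k" if "k < m2" "A2 (?div i) k = b2 k" for k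
        using g0[of "Inr k"] that by (auto simp: g_def K_def dd)
      have lint: "A (?div (i + t *\<^sub>R d)) k = A (?div i) k + t * A (?div d) k"
        if "linear_map ?V T A" for T A t and k :: nat
        using lin[OF that, of k] by (simp add: linear_iff)
      have "\<forall>\<^sub>F t in at_right 0. \<forall>e\<in>?E. 0 \<le> i e + t * d e"
        using finE i0 Zd by (intro eventually_ball_finite ballI eventually_affine_nonneg) auto
      then have evO: "\<forall>\<^sub>F t in at_right 0. i + t *\<^sub>R d \<in> orthant ?E"
      proof eventually_elim
        case (elim t)
        have "0 \<le> i e + t * d e" for e
          using elim i0[of e] by (cases "e \<in> ?E") (auto simp: d_def)
        then show ?case using iO dE by (intro orthantI) (auto simp: orthant_def coord_space_def)
      qed
      have "\<forall>\<^sub>F t in at_right 0. \<forall>k\<in>{..<m2}. 0 \<le> (A2 (?div i) k - b2 k) + t * A2 (?div d) k"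
        using A2i Kd by (intro eventually_ball_finite ballI eventually_affine_nonneg) auto
      then have evM: "\<forall>\<^sub>F t in at_right 0. ?div (i + t *\<^sub>R d) \<in> M"
      proof eventually_elim
        case (elim t)
        have "A1 (?div (i + t *\<^sub>R d)) = b1" by (rule ext) (simp add: lint[OF A1] A1d A1i)
        moreover have "\<forall>k<m2. b2 k \<le> A2 (?div (i + t *\<^sub>R d)) k"
          using elim by (force simp: lint[OF A2])
        ultimately show ?case by (simp add: feasible)
      qed
      have pos: "\<forall>\<^sub>F t in at_right (0::real). 0 < t"
        by (auto simp: eventually_at_right_field intro: exI[of _ 1])
      have "0 \<le> (\<Sum>e\<in>?E. ?g i e * d e)"
      proof (rule tendsto_lowerbound)
        show "((\<lambda>t. (H (i + t *\<^sub>R d) - H i) / t) \<longlongrightarrow> (\<Sum>e\<in>?E. ?g i e * d e)) (at_right 0)"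
          by (intro has_gradient_directional finE gradient_has_gradient H iO dE evO)
        show "\<forall>\<^sub>F t in at_right 0. 0 \<le> (H (i + t *\<^sub>R d) - H i) / t"
          using evO evM pos by eventually_elim (simp add: opt)
      qed simp
      then show "0 \<le> (\<Sum>e\<in>?E. ?g i e * d0 e)" by (simp add: d_def)
    qed (use finZ finK lin[OF A1] in auto)
    \<comment> \<open>The sign of \<open>u1\<close> compensates the minus sign of the
      \<open>A1\<close> term in \<open>adj\<close>. Setting \<open>u2\<close> to 0 at inactive rows
      gives complementary slackness.\<close>
    define u1 where "u1 k = (if k < m1 then - \<mu> k else 0)" for k
    define u2 where "u2 k = (if k \<in> K then c (Inr k) else 0)" for k
    have u1: "u1 \<in> coord_space {..<m1}" and u2: "u2 \<in> coord_space {..<m2}"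
      by (auto simp: u1_def u2_def K_def coord_space_def)
    \<comment> \<open>Subtracting \<open>adj\<close> from \<open>rep\<close> cancels all terms in
      the divergence; only the multipliers of the arcs in \<open>Z\<close> remain.\<close>
    have key: "(\<Sum>e\<in>?E. (?g i - difference G (u u1 u2)) e * d e) = (\<Sum>e\<in>Z. c (Inl e) * d e)" for d
    proof -
      have "(\<Sum>k<m2. A2 (?div d) k * u2 k) = (\<Sum>k\<in>K. c (Inr k) * A2 (?div d) k)"
        by (rule sum.mono_neutral_cong_right) (auto simp: K_def u2_def)
      moreover have "(\<Sum>k<m1. A1 (?div d) k * u1 k) = - (\<Sum>k<m1. \<mu> k * A1 (?div d) k)"
        by (simp add: u1_def sum_negf mult.commute)
      ultimately show ?thesis
        using rep[of d] adj[of u1 u2 d] finZ finK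
        by (simp add: left_diff_distrib sum_subtractf sum.Plus g_def)
    qed
    \<comment> \<open>The reduced gradient is a nonnegative multiplier where \<open>i e = 0\<close>
      and vanishes where \<open>i e > 0\<close>, so its minimum with \<open>i e\<close> is
      0.\<close>
    have slack: "(?g i - difference G (u u1 u2)) e = (if e \<in> Z then c (Inl e) else 0)"
      if "e \<in> ?E" for e
      using key[of "indicator {e}"] that finE finZ
      by (simp add: indicator_def if_distrib cong: if_cong)
    show ?thesis
    proof (intro bexI[OF _ u1] bexI[OF _ u2] conjI ballI allI impI)
      show "min (i e) ((?g i - difference G (u u1 u2)) e) = 0" if "e \<in> ?E" for e
        using slack[OF that] c[OF InlI, of e] i0[of e] that by (auto simp: Z_def)
      show "min ((A2 (?div i) - b2) k) (u2 k) = 0" if "k < m2" for k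
        using c[OF InrI, of k] A2i[OF that] that by (auto simp: u2_def K_def)
    qed (rule A1i)
  qed

  \<comment> \<open>Sufficiency under convexity\<close>
  have suf: "i \<in> BP G M H"
    if cv: "convex_on (orthant ?E) H" and i: "i \<in> coord_space ?E"
      and st: "\<forall>e\<in>?E. min (i e) ((?g i - difference G (u u1 u2)) e) = 0"
      and cs: "\<forall>k<m2. min ((A2 (?div i) - b2) k) (u2 k) = 0"
      and eq: "A1 (?div i) = b1" for i u1 u2
  proof -
    \<comment> \<open>A vanishing minimum of two reals is unpacked as two nonnegative numbers with
      product zero.\<close>
    have st': "0 \<le> i e" "0 \<le> ?g i e - difference G (u u1 u2) e"
      "(?g i e - difference G (u u1 u2) e) * i e = 0" if "e \<in> ?E" for e
      using st that by (force simp: min_def split: if_splits)+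
    have cs': "b2 k \<le> A2 (?div i) k" "0 \<le> u2 k" "(A2 (?div i) k - b2 k) * u2 k = 0"
      if "k < m2" for k
      using cs that by (force simp: min_def split: if_splits)+
    have "0 \<le> i e" for e
      using st'(1)[of e] i
      by (cases "e \<in> ?E") (auto simp: coord_space_def simp del: split_paired_All)
    then have iO: "i \<in> orthant ?E" using i by (intro orthantI)
    have iM: "?div i \<in> M" using eq cs' by (simp add: feasible)
    have "H i \<le> H j" if j: "j \<in> orthant ?E" and jM: "?div j \<in> M" for j
    proof -
      have j0: "0 \<le> j e" for e using j by (rule orthantD)
      have A1j: "A1 (?div j) = b1" and A2j: "\<And>k. k < m2 \<Longrightarrow> b2 k \<le> A2 (?div j) k"
        using jM by (auto simp: feasible)
      have lind: "A (?div (j - i)) k = A (?div j) k - A (?div i) k"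
        if "linear_map ?V T A" for T A and k :: nat
        by (rule linear_diff[OF lin[OF that]])
      \<comment> \<open>By complementary slackness \<open>A2 (?div i) k\<close> may be replaced by
        \<open>b2 k\<close> under the factor \<open>u2 k\<close>. The \<open>A1\<close> terms below
        vanish since \<open>i\<close> and \<open>j\<close> both attain \<open>b1\<close>.\<close>
      have "0 \<le> (A2 (?div j) k - A2 (?div i) k) * u2 k" if k: "k < m2" for k
        using A2j[OF k] cs'(2,3)[OF k] by auto
      then have "0 \<le> (\<Sum>k<m2. A2 (?div (j - i)) k * u2 k) - (\<Sum>k<m1. A1 (?div (j - i)) k * u1 k)"
        by (auto simp: lind[OF A1] lind[OF A2] A1j eq intro!: sum_nonneg)
      also have "\<dots> = (\<Sum>e\<in>?E. difference G (u u1 u2) e * (j e - i e))"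
        using adj[of u1 u2 "j - i"] by simp
      also have "\<dots> \<le> (\<Sum>e\<in>?E. ?g i e * (j e - i e))"
      proof (rule sum_mono)
        \<comment> \<open>The reduced gradient times \<open>j e - i e\<close> equals the reduced
          gradient times \<open>j e\<close>, because its product with \<open>i e\<close> is
          zero.\<close>
        fix e assume e: "e \<in> ?E"
        have "0 \<le> (?g i e - difference G (u u1 u2) e) * j e"
          using st'(2)[OF e] j0 by simp
        then show "difference G (u u1 u2) e * (j e - i e) \<le> ?g i e * (j e - i e)"
          using st'(3)[OF e] by (auto simp: left_diff_distrib)
      qed
      also have "\<dots> \<le> H j - H i"
        by (rule has_gradient_convex_le[OF finE cv gradient_has_gradient[OF finE H iO] iO j])
      finally show ?thesis by simp
    qed
    then show ?thesis using iO iM by (auto simp: BP_def is_arg_min_def not_less)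
  qed
  show ?thesis using nec suf by blast
qed

end
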